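(* Let $\bm{X}\in\mathbb{R}^{N\times D}$ have rows $\bm{x}_1,\dots,\bm{x}_N\in\mathbb{R}^D$, let $\beta>0$, and let $\Omega$ be a generalized negentropy with domain $\triangle_N$. Let $\bm{\mu}_{\bm{X}}:=\bm{X}^\top\mathbf{1}/N$, $M:=\max_i\|\bm{x}_i\|$, and define the Hopfield-Fenchel-Young energy $E=E_{\mathrm{concave}}+E_{\mathrm{convex}}:\mathbb{R}^D\to\mathbb{R}$ by $$E_{\mathrm{concave}}(\bm{q})=-\beta^{-1}L_\Omega(\beta\bm{X}\bm{q};\mathbf{1}/N),\qquad E_{\mathrm{convex}}(\bm{q})=\tfrac12\|\bm{q}-\bm{\mu}_{\bm{X}}\|^2+\tfrac12\left(M^2-\|\bm{\mu}_{\bm{X}}\|^2\right).$$ (1) If $\bm{q}$ lies in the convex hull of the rows of $\bm{X}$, i.e. $\bm{q}=\bm{X}^\top\bm{y}$ for some $\bm{y}\in\triangle_N$, then $$0\le E(\bm{q})\le\min\left\{2M^2,\;-\beta^{-1}\Omega(\mathbf{1}/N)+\tfrac12M^2\right\}.$$ (2) Minimizing $E$ with the concave-convex procedure (CCCP), using the decomposition $E=E_{\mathrm{concave}}+E_{\mathrm{convex}}$, leads to the updates $$\bm{q}^{(t+1)}=\bm{X}^\top\hat{\bm{y}}_\Omega(\beta\bm{X}\bm{q}^{(t)}).$$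
   Context: Notation: $\triangle_N=\{\bm{p}\in\mathbb{R}^N:\bm{p}\ge\mathbf{0},\ \mathbf{1}^\top\bm{p}=1\}$ is the probability simplex; $\bm{e}_i$ is the $i$-th standard basis vector; $\|\cdot\|$ is the Euclidean norm. Generalized negentropy: a function $\Omega:\mathbb{R}^N\to\mathbb{R}\cup\{+\infty\}$, finite exactly on $\triangle_N$, such that (i) $\Omega(\bm{e}_i)=0$ for all $i$; (ii) $\Omega$ is strictly convex on $\triangle_N$; (iii) $\Omega(\bm{P}\bm{y})=\Omega(\bm{y})$ for every permutation matrix $\bm{P}$. It is understood that the maximum defining $\hat{\bm{y}}_\Omega$ below is attained for every $\bm{\theta}$ (e.g. $\Omega$ is lower semicontinuous). Fenchel conjugate: $\Omega^*(\bm{\theta})=\sup_{\bm{y}}\bm{\theta}^\top\bm{y}-\Omega(\bm{y})$. Regularized argmax: $\hat{\bm{y}}_\Omega(\bm{\theta})=\nabla\Omega^*(\bm{\theta})=\arg\max_{\bm{y}\in\triangle_N}\bm{\theta}^\top\bm{y}-\Omega(\bm{y})$. Fenchel-Young loss: $L_\Omega(\bm{\theta};\bm{y})=\Omega(\bm{y})+\Omega^*(\bm{\theta})-\bm{\theta}^\top\bm{y}$. CCCP: given the current iterate $\bm{q}^{(t)}$, replace $E_{\mathrm{concave}}$ by its first-order Taylor approximation at $\bm{q}^{(t)}$, $\tilde E_{\mathrm{concave}}(\bm{q})=E_{\mathrm{concave}}(\bm{q}^{(t)})+\nabla E_{\mathrm{concave}}(\bm{q}^{(t)})^\top(\bm{q}-\bm{q}^{(t)})$,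 and set $\bm{q}^{(t+1)}=\arg\min_{\bm{q}\in\mathbb{R}^D}E_{\mathrm{convex}}(\bm{q})+\tilde E_{\mathrm{concave}}(\bm{q})$. *)

theory Defs
  imports "HOL-Analysis.Analysis"
begin

definition prob_simplex :: "(real ^ 'n) set" where
  "prob_simplex = {p. (\<forall>i. 0 \<le> p $ i) \<and> (\<Sum>i\<in>UNIV. p $ i) = 1}"

definition uniform_vec :: "real ^ 'n" where
  "uniform_vec = (\<chi> i. 1 / real CARD('n))"

definition permutation_matrix :: "real ^ 'n ^ 'n \<Rightarrow> bool" where
  "permutation_matrix P \<longleftrightarrow> (\<exists>\<pi>. bij \<pi> \<and> P = (\<chi> i j. if j = \<pi> i then 1 else 0))"

definition strictly_convex_on_simplex :: "(real ^ 'n \<Rightarrow> ereal) \<Rightarrow> bool" where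
  "strictly_convex_on_simplex \<Omega> \<longleftrightarrow>
     (\<forall>x\<in>prob_simplex. \<forall>y\<in>prob_simplex. \<forall>t. x \<noteq> y \<longrightarrow> 0 < t \<longrightarrow> t < 1 \<longrightarrow>
        \<Omega> ((1 - t) *\<^sub>R x + t *\<^sub>R y) < ereal (1 - t) * \<Omega> x + ereal t * \<Omega> y)"

definition generalized_negentropy :: "(real ^ 'n \<Rightarrow> ereal) \<Rightarrow> bool" where
  "generalized_negentropy \<Omega> \<longleftrightarrow>
     (\<forall>y. \<Omega> y \<noteq> - \<infinity>) \<and>
     (\<forall>y. \<Omega> y \<noteq> \<infinity> \<longleftrightarrow> y \<in> prob_simplex) \<and>
     (\<forall>i. \<Omega> (axis i 1) = 0) \<and>
     strictly_convex_on_simplex \<Omega> \<and>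
     (\<forall>P y. permutation_matrix P \<longrightarrow> \<Omega> (P *v y) = \<Omega> y)"

definition lower_semicontinuous :: "('a::topological_space \<Rightarrow> ereal) \<Rightarrow> bool" where
  "lower_semicontinuous f \<longleftrightarrow> (\<forall>x c. c < f x \<longrightarrow> (\<forall>\<^sub>F z in at x. c < f z))"

definition regularized_argmax_attained :: "(real ^ 'n \<Rightarrow> ereal) \<Rightarrow> bool" where
  "regularized_argmax_attained \<Omega> \<longleftrightarrow>
     (\<forall>\<theta>. \<exists>y. is_arg_max (\<lambda>y. ereal (\<theta> \<bullet> y) - \<Omega> y) (\<lambda>y. y \<in> prob_simplex) y)"

text \<open>The maximizer is unique by strict convexity, so the choice made by \<open>arg_max_on\<close> is immaterial
  whenever the maximum is attained (see \<open>regularized_argmax_unique\<close>).\<close>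

definition regularized_argmax :: "(real ^ 'n \<Rightarrow> ereal) \<Rightarrow> real ^ 'n \<Rightarrow> real ^ 'n" where
  "regularized_argmax \<Omega> \<theta> = arg_max_on (\<lambda>y. ereal (\<theta> \<bullet> y) - \<Omega> y) prob_simplex"

definition fenchel_conjugate :: "(real ^ 'n \<Rightarrow> ereal) \<Rightarrow> real ^ 'n \<Rightarrow> ereal" where
  "fenchel_conjugate \<Omega> \<theta> = (SUP y. ereal (\<theta> \<bullet> y) - \<Omega> y)"

definition fenchel_young_loss :: "(real ^ 'n \<Rightarrow> ereal) \<Rightarrow> real ^ 'n \<Rightarrow> real ^ 'n \<Rightarrow> ereal" where
  "fenchel_young_loss \<Omega> \<theta> y = \<Omega> y + fenchel_conjugate \<Omega> \<theta> - ereal (\<theta> \<bullet> y)"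

text \<open>A data matrix \<open>X :: real ^ 'd ^ 'n\<close> has \<open>CARD('n)\<close> rows \<open>X $ i\<close> in dimension \<open>CARD('d)\<close>.\<close>

definition mean_row :: "real ^ 'd ^ 'n \<Rightarrow> real ^ 'd" where
  "mean_row X = transpose X *v uniform_vec"

definition max_row_norm :: "real ^ 'd ^ 'n \<Rightarrow> real" where
  "max_row_norm X = Max (range (\<lambda>i. norm (X $ i)))"

text \<open>For a generalized negentropy whose regularized argmax is attained, the loss below is finite
  (see \<open>fenchel_young_loss_finite\<close>), so \<open>real_of_ereal\<close> loses nothing.\<close>

definition energy_concave ::
  "(real ^ 'n \<Rightarrow> ereal) \<Rightarrow> real \<Rightarrow> real ^ 'd ^ 'n \<Rightarrow> real ^ 'd \<Rightarrow> real" where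
  "energy_concave \<Omega> \<beta> X q =
     - (1 / \<beta>) * real_of_ereal (fenchel_young_loss \<Omega> (\<beta> *\<^sub>R (X *v q)) uniform_vec)"

definition energy_convex :: "real ^ 'd ^ 'n \<Rightarrow> real ^ 'd \<Rightarrow> real" where
  "energy_convex X q =
     1/2 * (norm (q - mean_row X))\<^sup>2 + 1/2 * ((max_row_norm X)\<^sup>2 - (norm (mean_row X))\<^sup>2)"

definition hfy_energy ::
  "(real ^ 'n \<Rightarrow> ereal) \<Rightarrow> real \<Rightarrow> real ^ 'd ^ 'n \<Rightarrow> real ^ 'd \<Rightarrow> real" where
  "hfy_energy \<Omega> \<beta> X q = energy_concave \<Omega> \<beta> X q + energy_convex X q"

text \<open>\<open>cccp_step f g q q'\<close>: from the iterate \<open>q\<close>, one step of the concave-convex procedure for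
  \<open>f + g\<close> with concave part \<open>f\<close> and convex part \<open>g\<close> may produce \<open>q'\<close>. No step is possible
  where \<open>f\<close> has no gradient.\<close>

definition cccp_step ::
  "('a::real_inner \<Rightarrow> real) \<Rightarrow> ('a \<Rightarrow> real) \<Rightarrow> 'a \<Rightarrow> 'a \<Rightarrow> bool" where
  "cccp_step f g q q' \<longleftrightarrow>
     (\<exists>D. GDERIV f q :> D \<and>
          is_arg_min (\<lambda>p. g p + (f q + D \<bullet> (p - q))) (\<lambda>_. True) q')"

lemma regularized_argmax_is_arg_max:
  assumes "regularized_argmax_attained \<Omega>"
  shows "is_arg_max (\<lambda>y. ereal (\<theta> \<bullet> y) - \<Omega> y) (\<lambda>y. y \<in> prob_simplex) (regularized_argmax \<Omega> \<theta>)"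
  using assms unfolding regularized_argmax_attained_def regularized_argmax_def arg_max_on_def
    arg_max_def by (metis (mono_tags, lifting) someI_ex)

lemma negentropy_real:
  assumes "generalized_negentropy \<Omega>" "y \<in> prob_simplex"
  obtains r where "\<Omega> y = ereal r"
  using assms unfolding generalized_negentropy_def by (cases "\<Omega> y") auto

lemma regularized_argmax_unique:
  assumes neg: "generalized_negentropy \<Omega>"
    and y: "is_arg_max (\<lambda>y. ereal (\<theta> \<bullet> y) - \<Omega> y) (\<lambda>y. y \<in> prob_simplex) y"
  shows "regularized_argmax \<Omega> \<theta> = y"
proof (rule ccontr)
  define z where "z = regularized_argmax \<Omega> \<theta>"
  assume "regularized_argmax \<Omega> \<theta> \<noteq> y"
  hence ne: "z \<noteq> y" by (simp add: z_def)
  have z: "is_arg_max (\<lambda>y. ereal (\<theta> \<bullet> y) - \<Omega> y) (\<lambda>y. y \<in> prob_simplex) z"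
    using y unfolding z_def regularized_argmax_def arg_max_on_def arg_max_def by (rule someI)
  have ys: "y \<in> prob_simplex" and zs: "z \<in> prob_simplex"
    using y z by (auto simp: is_arg_max_def)
  define w where "w = (1 - 1/2) *\<^sub>R z + (1/2::real) *\<^sub>R y"
  have ws: "w \<in> prob_simplex"
    using ys zs unfolding prob_simplex_def w_def
    by (auto simp: sum.distrib sum_divide_distrib[symmetric] intro!: add_nonneg_nonneg)
  obtain a where a: "\<Omega> y = ereal a" using neg ys by (rule negentropy_real)
  obtain b where b: "\<Omega> z = ereal b" using neg zs by (rule negentropy_real)
  obtain c where c: "\<Omega> w = ereal c" using neg ws by (rule negentropy_real)
  have "strictly_convex_on_simplex \<Omega>" using neg by (simp add: generalized_negentropy_def)
  hence "\<Omega> w < ereal (1 - 1/2) * \<Omega> z + ereal (1/2) * \<Omega> y"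
    unfolding strictly_convex_on_simplex_def w_def
    using ys zs ne by (elim ballE[of _ _ z] ballE[of _ _ y] allE[of _ "1/2"]) simp_all
  hence "c < b / 2 + a / 2" by (simp add: a b c)
  moreover have "\<theta> \<bullet> w - c \<le> \<theta> \<bullet> y - a" "\<theta> \<bullet> w - c \<le> \<theta> \<bullet> z - b"
    using y z ws a b c by (auto simp: is_arg_max_linorder)
  moreover have "\<theta> \<bullet> w = (\<theta> \<bullet> z) / 2 + (\<theta> \<bullet> y) / 2"
    by (simp add: w_def inner_add_right)
  ultimately show False by argo
qed

lemma fenchel_conjugate_eq:
  assumes neg: "generalized_negentropy \<Omega>" and "regularized_argmax_attained \<Omega>"
  shows "fenchel_conjugate \<Omega> \<theta> = ereal (\<theta> \<bullet> regularized_argmax \<Omega> \<theta>) - \<Omega> (regularized_argmax \<Omega> \<theta>)"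
  unfolding fenchel_conjugate_def
proof (intro antisym SUP_least)
  fix y
  show "ereal (\<theta> \<bullet> y) - \<Omega> y
      \<le> ereal (\<theta> \<bullet> regularized_argmax \<Omega> \<theta>) - \<Omega> (regularized_argmax \<Omega> \<theta>)"
  proof (cases "y \<in> prob_simplex")
    case True
    then show ?thesis
      using regularized_argmax_is_arg_max[OF assms(2), of \<theta>] by (auto simp: is_arg_max_linorder)
  next
    case False
    then have "\<Omega> y = \<infinity>" using neg unfolding generalized_negentropy_def by blast
    then show ?thesis by simp
  qed
qed (rule SUP_upper, simp)

lemma fenchel_young_loss_finite:
  assumes neg: "generalized_negentropy \<Omega>" and att: "regularized_argmax_attained \<Omega>"
    and y: "y \<in> prob_simplex"
  shows "\<bar>fenchel_young_loss \<Omega> \<theta> y\<bar> \<noteq> \<infinity>"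
proof -
  have "regularized_argmax \<Omega> \<theta> \<in> prob_simplex"
    using regularized_argmax_is_arg_max[OF att] by (auto simp: is_arg_max_def)
  with neg obtain b where b: "\<Omega> (regularized_argmax \<Omega> \<theta>) = ereal b" by (rule negentropy_real)
  obtain a where a: "\<Omega> y = ereal a" using neg y by (rule negentropy_real)
  show ?thesis by (simp add: fenchel_young_loss_def fenchel_conjugate_eq[OF neg att] a b)
qed

lemma gradient_fenchel_conjugate:
  assumes neg: "generalized_negentropy \<Omega>" and att: "regularized_argmax_attained \<Omega>"
    and D: "GDERIV (\<lambda>\<theta>. real_of_ereal (fenchel_conjugate \<Omega> \<theta>)) \<theta> :> D"
  shows "D = regularized_argmax \<Omega> \<theta>"
proof -
  define y where "y = regularized_argmax \<Omega>"
  define f where "f \<theta> = real_of_ereal (fenchel_conjugate \<Omega> \<theta>)" for \<theta>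
  have ys: "y \<phi> \<in> prob_simplex" for \<phi>
    using regularized_argmax_is_arg_max[OF att, of \<phi>] by (auto simp: is_arg_max_def y_def)
  have sub: "f \<phi> \<ge> f \<theta> + (\<phi> - \<theta>) \<bullet> y \<theta>" for \<phi>
  proof -
    obtain a where a: "\<Omega> (y \<theta>) = ereal a" using neg ys by (rule negentropy_real)
    obtain b where b: "\<Omega> (y \<phi>) = ereal b" using neg ys by (rule negentropy_real)
    have "\<phi> \<bullet> y \<theta> - a \<le> \<phi> \<bullet> y \<phi> - b"
      using regularized_argmax_is_arg_max[OF att, of \<phi>, folded y_def] ys[of \<theta>] a b
      by (auto simp: is_arg_max_linorder)
    then show ?thesis
      using a b by (simp add: f_def fenchel_conjugate_eq[OF neg att, folded y_def] inner_diff_left)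
  qed
  have "((\<lambda>\<phi>. f \<phi> - \<phi> \<bullet> y \<theta>) has_derivative (\<lambda>h. h \<bullet> D - h \<bullet> y \<theta>)) (at \<theta>)"
    using D unfolding gderiv_def f_def by (auto intro!: derivative_eq_intros)
  then have "(\<lambda>h. h \<bullet> D - h \<bullet> y \<theta>) = (\<lambda>h. 0)"
    using sub by (intro differential_zero_maxmin[of \<theta> UNIV]) (auto simp: inner_diff_left algebra_simps)
  then have "(D - y \<theta>) \<bullet> D - (D - y \<theta>) \<bullet> y \<theta> = 0" by metis
  then show ?thesis by (simp add: y_def inner_diff_right[symmetric])
qed

lemma convex_hull_rows:
  fixes X :: "real ^ 'd ^ 'n"
  shows "convex hull (rows X) = {transpose X *v y | y. y \<in> prob_simplex}"
proof -
  have ax: "prob_simplex = convex hull (range (\<lambda>i::'n. axis i (1::real)))"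
  proof -
    have cv: "convex (prob_simplex :: (real ^ 'n) set)"
      unfolding convex_def prob_simplex_def
      by (auto simp: sum.distrib sum_distrib_left[symmetric])
    have "y \<in> convex hull (range (\<lambda>i::'n. axis i (1::real)))" if "y \<in> prob_simplex" for y
    proof -
      have "(\<Sum>i\<in>UNIV. y $ i *\<^sub>R axis i (1::real)) \<in> convex hull (range (\<lambda>i::'n. axis i (1::real)))"
        using that by (intro convex_sum) (auto simp: prob_simplex_def hull_inc)
      moreover have "(\<Sum>i\<in>UNIV. y $ i *\<^sub>R axis i (1::real)) = y"
        using basis_expansion[of y] by (simp add: scalar_mult_eq_scaleR)
      ultimately show ?thesis by simp
    qed
    moreover have "convex hull (range (\<lambda>i::'n. axis i (1::real))) \<subseteq> prob_simplex"
      using cv by (intro hull_minimal) (auto simp: prob_simplex_def axis_def)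
    ultimately show ?thesis by blast
  qed
  have "rows X = (*v) (transpose X) ` range (\<lambda>i. axis i 1)"
    by (auto simp: rows_def row_def image_def column_def transpose_def matrix_vector_mult_basis)
  then have "convex hull (rows X) = (*v) (transpose X) ` prob_simplex"
    using convex_hull_linear_image[OF matrix_vector_mul_linear, of "transpose X"] ax by metis
  then show ?thesis by blast
qed

lemma uniform_vec_in_prob_simplex: "uniform_vec \<in> prob_simplex"
  by (simp add: uniform_vec_def prob_simplex_def)

end

theory Submission
  imports Defs
begin

text \<open>
  Expanding the squares gives
  \<open>E q = - (\<Omega> u + \<Omega>\<^sup>* (\<beta> X q)) / \<beta> + \<parallel>q\<parallel>\<^sup>2 / 2 + M\<^sup>2 / 2\<close> with \<open>u\<close> the uniform
  vector. Averaging over all permutations, convexity and symmetry make \<open>u\<close> a minimizer of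
  \<open>\<Omega>\<close> on the simplex, so \<open>\<Omega> u + \<Omega>\<^sup>* (\<beta> X q)\<close> is at most \<open>\<beta> (X q \<bullet> y)\<close> for the maximizer
  \<open>y\<close>, and \<open>2 (q \<bullet> X\<^sup>T y) \<le> \<parallel>q\<parallel>\<^sup>2 + M\<^sup>2\<close> yields \<open>0 \<le> E q\<close>. The upper bounds come from
  \<open>L\<^sub>\<Omega> \<ge> 0\<close> and from the Fenchel-Young inequality at the weights \<open>y\<close> of \<open>q = X\<^sup>T y\<close>, where
  \<open>\<Omega> y \<le> 0\<close>. For CCCP, the maximizer \<open>y\<close> is a subgradient of \<open>\<Omega>\<^sup>*\<close>, so the gradient of
  the concave part, where it exists, is \<open>\<mu> - X\<^sup>T y\<close>. Under lower semicontinuity the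
  maximizer has a closed graph in a compact set, hence depends continuously on \<open>\<theta>\<close>, and a
  continuous selection of subgradients is a gradient.
\<close>

section \<open>The simplex and the convex hull of the rows\<close>

lemma convex_prob_simplex: "convex (prob_simplex :: (real ^ 'n) set)"
  unfolding convex_def prob_simplex_def
  by (auto simp: sum.distrib sum_distrib_left[symmetric])

lemma compact_prob_simplex: "compact (prob_simplex :: (real ^ 'n) set)"
proof -
  have "closed (prob_simplex :: (real ^ 'n) set)"
    unfolding prob_simplex_def
    by (intro closed_Collect_conj closed_Collect_all closed_Collect_le closed_Collect_eq continuous_intros)
  moreover have "norm y \<le> 1" if "y \<in> prob_simplex" for y :: "real ^ 'n"
    using norm_le_l1_cart[of y] that by (simp add: prob_simplex_def)
  ultimately show ?thesis
    by (auto simp: compact_eq_bounded_closed bounded_iff)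
qed

lemma axis_in_prob_simplex: "axis i 1 \<in> prob_simplex"
  by (auto simp: prob_simplex_def axis_def)

lemma vec_expansion: "(\<Sum>i\<in>UNIV. y $ i *\<^sub>R axis i (1::real)) = y"
  using basis_expansion[of y] by (simp add: scalar_mult_eq_scaleR)

lemma transpose_mult_in_hull:
  "y \<in> prob_simplex \<Longrightarrow> transpose X *v y \<in> convex hull (rows X)"
  unfolding convex_hull_rows by blast

lemma norm_row_le_max_row_norm: "norm (X $ i) \<le> max_row_norm X"
  unfolding max_row_norm_def by (rule Max_ge) auto

text \<open>A ball is convex, so one that contains the rows contains their hull.\<close>

lemma norm_le_max_row_norm:
  assumes "q \<in> convex hull (rows X)"
  shows "norm q \<le> max_row_norm X"
proof -
  have "convex hull (rows X) \<subseteq> cball 0 (max_row_norm X)"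
    by (rule hull_minimal)
      (auto simp: rows_def row_def vec_lambda_eta norm_row_le_max_row_norm)
  then show ?thesis using assms by auto
qed

lemma inner_matrix_vector_transpose:
  fixes X :: "real ^ 'd ^ 'n"
  shows "(X *v q) \<bullet> y = q \<bullet> (transpose X *v y)"
  by (metis dot_lmul_matrix transpose_matrix_vector inner_commute)

text \<open>The squares of \<open>norm (mean_row X)\<close> cancel. The remaining linear term is the
  opposite of the one in \<open>energy_concave_eq\<close>, so the total energy has none.\<close>

lemma energy_convex_eq:
  "energy_convex X q = (norm q)\<^sup>2 / 2 - q \<bullet> mean_row X + (max_row_norm X)\<^sup>2 / 2"
  by (simp add: energy_convex_def power2_norm_eq_inner inner_diff_left inner_diff_right
      inner_commute field_simps)

text \<open>Completing the square: the linearized objective is \<open>1/2 * (norm (p - (mean_row X - D)))\<^sup>2\<close>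
  up to a constant.\<close>

lemma is_arg_min_energy_convex_linear:
  "is_arg_min (\<lambda>p. energy_convex X p + (c + D \<bullet> (p - q))) (\<lambda>_. True) q'
    \<longleftrightarrow> q' = mean_row X - D"
proof -
  define m where "m = mean_row X - D"
  define k where "k = (max_row_norm X)\<^sup>2 / 2 + c - D \<bullet> q - (norm m)\<^sup>2 / 2"
  have *: "energy_convex X p + (c + D \<bullet> (p - q)) = (norm (p - m))\<^sup>2 / 2 + k" for p
    by (simp add: energy_convex_eq k_def m_def power2_norm_eq_inner inner_diff_left
        inner_diff_right inner_add_left inner_add_right inner_commute field_simps)
  show ?thesis
    unfolding * m_def[symmetric]
  proof
    assume "is_arg_min (\<lambda>p. (norm (p - m))\<^sup>2 / 2 + k) (\<lambda>_. True) q'"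
    then have "(norm (q' - m))\<^sup>2 / 2 + k \<le> (norm (m - m))\<^sup>2 / 2 + k"
      unfolding is_arg_min_linorder by blast
    then show "q' = m" by simp
  qed (simp add: is_arg_min_linorder)
qed

lemma gderiv_unique:
  assumes "GDERIV f x :> D" "GDERIV f x :> D'"
  shows "D = D'"
proof -
  have "(\<lambda>h. h \<bullet> D) = (\<lambda>h. h \<bullet> D')"
    using assms unfolding gderiv_def by (rule has_derivative_unique)
  then show ?thesis by (metis inner_commute vector_eq_rdot)
qed

text \<open>Composing with the transposition of \<open>i\<close> and \<open>j\<close> permutes the
  summands, so all coordinates of the sum agree. Each permuted copy of \<open>y\<close> has total
  mass 1, which fixes their common value.\<close>

lemma permutation_average:
  assumes "y \<in> (prob_simplex :: (real ^ 'n) set)"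
  shows "(\<Sum>\<pi> | \<pi> permutes UNIV. (1 / fact CARD('n)) *\<^sub>R (\<chi> i. y $ \<pi> i)) = uniform_vec"
proof -
  define S where "S = {\<pi>. \<pi> permutes (UNIV :: 'n set)}"
  have card: "real (card S) = fact CARD('n)"
    unfolding S_def by (subst card_permutations[OF refl]) auto
  define s where "s i = (\<Sum>\<pi>\<in>S. y $ \<pi> i)" for i
  have eq: "s i = s j" for i j
    unfolding s_def
    by (rule sum.reindex_bij_witness[where i = "\<lambda>\<pi>. \<pi> \<circ> Transposition.transpose i j" and j = "\<lambda>\<pi>. \<pi> \<circ> Transposition.transpose i j"])
      (auto simp: S_def o_assoc[symmetric] intro!: permutes_compose permutes_swap_id)
  have "(\<Sum>i\<in>UNIV. s i) = (\<Sum>\<pi>\<in>S. \<Sum>i\<in>UNIV. y $ \<pi> i)"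
    unfolding s_def by (rule sum.swap)
  also have "\<dots> = (\<Sum>\<pi>\<in>S. \<Sum>i\<in>UNIV. y $ i)"
    by (intro sum.cong refl sum.reindex_bij_betw) (auto simp: S_def permutes_imp_bij)
  also have "\<dots> = fact CARD('n)"
    using assms card by (simp add: prob_simplex_def)
  finally have "(\<Sum>i\<in>UNIV. s i) = fact CARD('n)" .
  moreover have "(\<Sum>j\<in>UNIV. s j) = (\<Sum>j\<in>(UNIV :: 'n set). s i)" for i
    by (intro sum.cong refl eq)
  ultimately have "CARD('n) * s i = fact CARD('n)" for i
    by simp
  then show ?thesis
    by (simp add: vec_eq_iff uniform_vec_def S_def[symmetric] s_def[symmetric]
        sum_divide_distrib[symmetric] field_simps)
qed

section \<open>Convexity and symmetry of the negentropy\<close>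

context
  fixes \<Omega> :: "real ^ 'n \<Rightarrow> ereal"
  assumes neg: "generalized_negentropy \<Omega>"
begin

lemma negentropy_ereal: "y \<in> prob_simplex \<Longrightarrow> \<Omega> y = ereal (real_of_ereal (\<Omega> y))"
  using neg by (metis negentropy_real real_of_ereal.simps(1))

text \<open>Strict convexity in \<open>ereal\<close> becomes real convexity, the form in which
  Jensen's inequality \<open>convex_on_sum\<close> applies.\<close>

lemma convex_on_negentropy: "convex_on prob_simplex (\<lambda>y. real_of_ereal (\<Omega> y))"
proof (rule convex_onI)
  fix t :: real and x y :: "real ^ 'n"
  assume *: "0 < t" "t < 1" "x \<in> prob_simplex" "y \<in> prob_simplex"
  define z where "z = (1 - t) *\<^sub>R x + t *\<^sub>R y"
  have z: "z \<in> prob_simplex"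
    unfolding z_def using * convex_prob_simplex by (auto simp: convex_alt)
  show "real_of_ereal (\<Omega> ((1 - t) *\<^sub>R x + t *\<^sub>R y))
      \<le> (1 - t) * real_of_ereal (\<Omega> x) + t * real_of_ereal (\<Omega> y)"
  \<comment> \<open>Strict convexity speaks only of distinct points.\<close>
  proof (cases "x = y")
    case True
    then show ?thesis by (simp add: algebra_simps flip: scaleR_add_left)
  next
    case False
    then have "\<Omega> z < ereal (1 - t) * \<Omega> x + ereal t * \<Omega> y"
      using neg * unfolding generalized_negentropy_def strictly_convex_on_simplex_def z_def by blast
    then have "ereal (real_of_ereal (\<Omega> z))
        < ereal ((1 - t) * real_of_ereal (\<Omega> x) + t * real_of_ereal (\<Omega> y))"
      using negentropy_ereal[OF z] negentropy_ereal[OF *(3)] negentropy_ereal[OF *(4)]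
      by (metis plus_ereal.simps(1) times_ereal.simps(1))
    then show ?thesis by (simp add: z_def)
  qed
qed (rule convex_prob_simplex)

text \<open>Jensen's inequality over the vertices of the simplex, where \<open>\<Omega>\<close>
  vanishes.\<close>

lemma negentropy_nonpos:
  assumes "y \<in> prob_simplex"
  shows "real_of_ereal (\<Omega> y) \<le> 0"
proof -
  have "real_of_ereal (\<Omega> (\<Sum>i\<in>UNIV. y $ i *\<^sub>R axis i 1))
      \<le> (\<Sum>i\<in>UNIV. y $ i * real_of_ereal (\<Omega> (axis i 1)))"
    using assms by (intro convex_on_sum[OF _ _ convex_on_negentropy])
      (simp_all add: axis_in_prob_simplex, simp_all add: prob_simplex_def)
  then show ?thesis
    using neg by (simp add: vec_expansion generalized_negentropy_def)
qed

lemma negentropy_permute: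
  assumes "\<pi> permutes UNIV"
  shows "\<Omega> (\<chi> i. y $ \<pi> i) = \<Omega> y"
proof -
  define P :: "real ^ 'n ^ 'n" where "P = (\<chi> i j. if j = \<pi> i then 1 else 0)"
  have "permutation_matrix P"
    unfolding permutation_matrix_def P_def using permutes_bij[OF assms] by blast
  moreover have "P *v y = (\<chi> i. y $ \<pi> i)"
    by (simp add: vec_eq_iff P_def matrix_vector_mult_def if_distrib[of "\<lambda>a. a * _"] cong: if_cong)
  ultimately show ?thesis
    using neg by (metis generalized_negentropy_def)
qed

text \<open>Jensen's inequality for the average of all permuted copies of \<open>y\<close>, on each
  of which \<open>\<Omega>\<close> takes the value \<open>\<Omega> y\<close>.\<close>

lemma negentropy_uniform_le:
  assumes "y \<in> prob_simplex"
  shows "real_of_ereal (\<Omega> uniform_vec) \<le> real_of_ereal (\<Omega> y)"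
proof -
  define S where "S = {\<pi>. \<pi> permutes (UNIV :: 'n set)}"
  have card: "real (card S) = fact CARD('n)"
    unfolding S_def by (subst card_permutations[OF refl]) auto
  have fin: "finite S" unfolding S_def by (rule finite_permutations) simp
  have mem: "(\<chi> i. y $ \<pi> i) \<in> prob_simplex" if "\<pi> \<in> S" for \<pi>
    using assms that sum.reindex_bij_betw[of \<pi> UNIV UNIV "\<lambda>i. y $ i"]
    by (auto simp: prob_simplex_def S_def permutes_imp_bij)
  have "real_of_ereal (\<Omega> (\<Sum>\<pi>\<in>S. (1 / fact CARD('n)) *\<^sub>R (\<chi> i. y $ \<pi> i)))
      \<le> (\<Sum>\<pi>\<in>S. (1 / fact CARD('n)) * real_of_ereal (\<Omega> (\<chi> i. y $ \<pi> i)))"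
    using fin card mem by (intro convex_on_sum[OF _ _ convex_on_negentropy])
      (auto simp: S_def intro: permutes_id)
  also have "\<dots> = (\<Sum>\<pi>\<in>S. (1 / fact CARD('n)) * real_of_ereal (\<Omega> y))"
    by (intro sum.cong) (auto simp: S_def negentropy_permute)
  also have "\<dots> = real_of_ereal (\<Omega> y)"
    using card by simp
  finally show ?thesis
    by (simp add: permutation_average[OF assms] S_def)
qed

section \<open>The Fenchel conjugate as a real function\<close>

context
  assumes att: "regularized_argmax_attained \<Omega>"
begin

lemma regularized_argmax_in_prob_simplex: "regularized_argmax \<Omega> \<theta> \<in> prob_simplex"
  using regularized_argmax_is_arg_max[OF att] by (auto simp: is_arg_max_def)

lemma fenchel_conjugate_real:
  "fenchel_conjugate \<Omega> \<theta> = ereal (real_of_ereal (fenchel_conjugate \<Omega> \<theta>))"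
  using negentropy_ereal[OF regularized_argmax_in_prob_simplex[of \<theta>]]
  by (metis fenchel_conjugate_eq[OF neg att] ereal_minus(1) real_of_ereal.simps(1))

lemma real_fenchel_conjugate:
  "real_of_ereal (fenchel_conjugate \<Omega> \<theta>)
    = \<theta> \<bullet> regularized_argmax \<Omega> \<theta> - real_of_ereal (\<Omega> (regularized_argmax \<Omega> \<theta>))"
  using negentropy_ereal[OF regularized_argmax_in_prob_simplex[of \<theta>]]
  by (metis fenchel_conjugate_eq[OF neg att] ereal_minus(1) real_of_ereal.simps(1))

lemma fenchel_young_inequality:
  assumes "y \<in> prob_simplex"
  shows "\<theta> \<bullet> y - real_of_ereal (\<Omega> y) \<le> real_of_ereal (fenchel_conjugate \<Omega> \<theta>)"
proof -
  have "ereal (\<theta> \<bullet> y) - \<Omega> y \<le> fenchel_conjugate \<Omega> \<theta>"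
    unfolding fenchel_conjugate_def by (rule SUP_upper) simp
  then show ?thesis
    using negentropy_ereal[OF assms] fenchel_conjugate_real
    by (metis ereal_less_eq(3) ereal_minus(1))
qed

text \<open>The maximizer at \<open>\<theta>\<close> remains a competitor in the supremum at
  \<open>\<phi>\<close>.\<close>

lemma fenchel_conjugate_subgradient:
  "real_of_ereal (fenchel_conjugate \<Omega> \<theta>) + (\<phi> - \<theta>) \<bullet> regularized_argmax \<Omega> \<theta>
    \<le> real_of_ereal (fenchel_conjugate \<Omega> \<phi>)"
  using fenchel_young_inequality[OF regularized_argmax_in_prob_simplex[of \<theta>], of \<phi>]
  by (simp add: real_fenchel_conjugate[of \<theta>] inner_diff_left)

lemma real_fenchel_young_loss:
  assumes "y \<in> prob_simplex"
  shows "real_of_ereal (fenchel_young_loss \<Omega> \<theta> y)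
    = real_of_ereal (\<Omega> y) + real_of_ereal (fenchel_conjugate \<Omega> \<theta>) - \<theta> \<bullet> y"
  unfolding fenchel_young_loss_def
  by (subst negentropy_ereal[OF assms], subst fenchel_conjugate_real) simp

section \<open>Bounds on the energy\<close>

lemma energy_concave_eq:
  assumes "\<beta> > 0"
  shows "energy_concave \<Omega> \<beta> X q =
    - (real_of_ereal (\<Omega> uniform_vec) + real_of_ereal (fenchel_conjugate \<Omega> (\<beta> *\<^sub>R (X *v q)))) / \<beta>
    + q \<bullet> mean_row X"
  using assms
  by (simp add: energy_concave_def real_fenchel_young_loss uniform_vec_in_prob_simplex
      inner_matrix_vector_transpose mean_row_def field_simps)

lemma energy_concave_nonpos:
  assumes "\<beta> > 0"
  shows "energy_concave \<Omega> \<beta> X q \<le> 0"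
  using assms fenchel_young_inequality[OF uniform_vec_in_prob_simplex, of "\<beta> *\<^sub>R (X *v q)"]
  by (simp add: energy_concave_def real_fenchel_young_loss uniform_vec_in_prob_simplex)

lemma hfy_energy_eq:
  assumes "\<beta> > 0"
  shows "hfy_energy \<Omega> \<beta> X q =
    - (real_of_ereal (\<Omega> uniform_vec) + real_of_ereal (fenchel_conjugate \<Omega> (\<beta> *\<^sub>R (X *v q)))) / \<beta>
    + (norm q)\<^sup>2 / 2 + (max_row_norm X)\<^sup>2 / 2"
  by (simp add: hfy_energy_def energy_concave_eq[OF assms] energy_convex_eq)

lemma hfy_energy_nonneg:
  assumes "\<beta> > 0"
  shows "0 \<le> hfy_energy \<Omega> \<beta> X q"
proof -
  define y where "y = regularized_argmax \<Omega> (\<beta> *\<^sub>R (X *v q))"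
  define p where "p = transpose X *v y"
  have y: "y \<in> prob_simplex" unfolding y_def by (rule regularized_argmax_in_prob_simplex)
  have "norm p \<le> max_row_norm X"
    unfolding p_def by (intro norm_le_max_row_norm transpose_mult_in_hull y)
  then have "(norm p)\<^sup>2 \<le> (max_row_norm X)\<^sup>2" by (simp add: power_mono)
  moreover have "0 \<le> (norm (q - p))\<^sup>2" by simp
  \<comment> \<open>Expand the square of \<open>norm (q - p)\<close> and bound \<open>norm p\<close>
    by the largest row norm.\<close>
  ultimately have "2 * (q \<bullet> p) \<le> (norm q)\<^sup>2 + (max_row_norm X)\<^sup>2"
    by (simp add: power2_norm_eq_inner inner_diff_left inner_diff_right inner_commute)
  moreover have "real_of_ereal (\<Omega> uniform_vec)
      + real_of_ereal (fenchel_conjugate \<Omega> (\<beta> *\<^sub>R (X *v q))) \<le> \<beta> * (q \<bullet> p)"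
    using negentropy_uniform_le[OF y] real_fenchel_conjugate[of "\<beta> *\<^sub>R (X *v q)"]
    by (simp add: y_def[symmetric] inner_matrix_vector_transpose p_def)
  then have "(real_of_ereal (\<Omega> uniform_vec)
      + real_of_ereal (fenchel_conjugate \<Omega> (\<beta> *\<^sub>R (X *v q)))) / \<beta> \<le> q \<bullet> p"
    using assms by (simp add: divide_le_eq mult.commute)
  ultimately show ?thesis
    unfolding hfy_energy_eq[OF assms] minus_divide_left[symmetric] by linarith
qed

text \<open>The concave part is at most 0. In the expanded convex part both squares contribute at
  most half of \<open>?M\<^sup>2\<close>, and the inner product at most \<open>?M\<^sup>2\<close> by
  Cauchy-Schwarz.\<close>

lemma hfy_energy_le_norm_bound:
  assumes "\<beta> > 0" and q: "q \<in> convex hull (rows X)"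
  shows "hfy_energy \<Omega> \<beta> X q \<le> 2 * (max_row_norm X)\<^sup>2"
proof -
  let ?M = "max_row_norm X"
  have m: "norm (mean_row X) \<le> ?M"
    unfolding mean_row_def
    by (intro norm_le_max_row_norm transpose_mult_in_hull uniform_vec_in_prob_simplex)
  have "norm q \<le> ?M" by (rule norm_le_max_row_norm[OF q])
  then have "(norm q)\<^sup>2 \<le> ?M\<^sup>2" "norm q * norm (mean_row X) \<le> ?M\<^sup>2"
    using m by (auto simp: power_mono power2_eq_square intro!: mult_mono order_trans[OF norm_ge_zero])
  then show ?thesis
    using energy_concave_nonpos[OF assms(1), of X q] Cauchy_Schwarz_ineq2[of q "mean_row X"]
    by (simp add: hfy_energy_def energy_convex_eq)
qed

lemma hfy_energy_le_negentropy_bound: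
  assumes "\<beta> > 0" and q: "q \<in> convex hull (rows X)"
  shows "hfy_energy \<Omega> \<beta> X q
    \<le> - (1 / \<beta>) * real_of_ereal (\<Omega> uniform_vec) + 1/2 * (max_row_norm X)\<^sup>2"
proof -
  obtain y where y: "y \<in> prob_simplex" and qy: "q = transpose X *v y"
    using q unfolding convex_hull_rows by blast
  have eq: "(X *v q) \<bullet> y = (norm q)\<^sup>2"
    by (simp only: inner_matrix_vector_transpose qy[symmetric] power2_norm_eq_inner)
  have "\<beta> * (norm q)\<^sup>2 \<le> real_of_ereal (fenchel_conjugate \<Omega> (\<beta> *\<^sub>R (X *v q)))"
    using fenchel_young_inequality[OF y, of "\<beta> *\<^sub>R (X *v q)", unfolded inner_scaleR_left eq]
      negentropy_nonpos[OF y] by linarith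
  then have "(norm q)\<^sup>2 \<le> real_of_ereal (fenchel_conjugate \<Omega> (\<beta> *\<^sub>R (X *v q))) / \<beta>"
    using assms(1) by (simp add: field_simps)
  moreover have "- (1 / \<beta>) * real_of_ereal (\<Omega> uniform_vec) = - (real_of_ereal (\<Omega> uniform_vec) / \<beta>)"
    by simp
  \<comment> \<open>The conjugate contributes at most \<open>- (norm q)\<^sup>2\<close> and the
    convex part half of \<open>(norm q)\<^sup>2\<close>; the negative remainder is dropped.\<close>
  ultimately show ?thesis
    using zero_le_power2[of "norm q"]
    unfolding hfy_energy_eq[OF assms(1)] minus_divide_left[symmetric] add_divide_distrib
    by linarith
qed

section \<open>Gradient of the concave part and CCCP steps\<close>

lemma energy_concave_supergradient:
  assumes "\<beta> > 0"
  shows "energy_concave \<Omega> \<beta> X p \<le> energy_concave \<Omega> \<beta> X q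
    + (mean_row X - transpose X *v regularized_argmax \<Omega> (\<beta> *\<^sub>R (X *v q))) \<bullet> (p - q)"
proof -
  define f where "f p = real_of_ereal (fenchel_conjugate \<Omega> (\<beta> *\<^sub>R (X *v p)))" for p
  define y where "y = regularized_argmax \<Omega> (\<beta> *\<^sub>R (X *v q))"
  \<comment> \<open>The subgradient of the conjugate is pulled back along the linear map; the factor
    \<open>\<beta>\<close> will cancel against the one in the energy.\<close>
  have "f q + \<beta> * ((transpose X *v y) \<bullet> (p - q)) \<le> f p"
    using fenchel_conjugate_subgradient[of "\<beta> *\<^sub>R (X *v q)" "\<beta> *\<^sub>R (X *v p)"]
    by (simp add: f_def y_def inner_matrix_vector_transpose inner_commute
        flip: scaleR_diff_right matrix_vector_mult_diff_distrib)
  from divide_right_mono[OF this, of \<beta>]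
  have "f q / \<beta> + (transpose X *v y) \<bullet> (p - q) \<le> f p / \<beta>"
    using assms by (simp add: add_divide_distrib)
  then show ?thesis
    by (simp add: energy_concave_eq[OF assms] f_def[symmetric] y_def[symmetric] inner_diff_left
        inner_diff_right inner_commute add_divide_distrib diff_divide_distrib)
qed

text \<open>Subtracting the linear function given by the supergradient leaves a function maximal at
  \<open>q\<close>, so its derivative there is zero.\<close>

lemma gderiv_energy_concave:
  assumes "\<beta> > 0" and "energy_concave \<Omega> \<beta> X differentiable (at q)"
  shows "GDERIV (energy_concave \<Omega> \<beta> X) q :>
    mean_row X - transpose X *v regularized_argmax \<Omega> (\<beta> *\<^sub>R (X *v q))"
proof -
  define D where "D = mean_row X - transpose X *v regularized_argmax \<Omega> (\<beta> *\<^sub>R (X *v q))"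
  obtain F where F: "(energy_concave \<Omega> \<beta> X has_derivative F) (at q)"
    using assms(2) by (auto simp: differentiable_def)
  have "((\<lambda>p. energy_concave \<Omega> \<beta> X p - p \<bullet> D) has_derivative (\<lambda>h. F h - h \<bullet> D)) (at q)"
    using F by (auto intro!: derivative_eq_intros)
  then have "(\<lambda>h. F h - h \<bullet> D) = (\<lambda>h. 0)"
    using energy_concave_supergradient[OF assms(1), of X _ q, folded D_def]
    by (intro differential_zero_maxmin[of q UNIV])
      (auto simp: inner_diff_right inner_commute algebra_simps)
  then have "F = (\<lambda>h. h \<bullet> D)" by (metis eq_iff_diff_eq_0)
  then show ?thesis using F by (simp add: gderiv_def D_def)
qed

text \<open>The gradient is unique and the linearized problem has \<open>mean_row X - D\<close> as
  its only minimizer, so the two copies of \<open>mean_row X\<close> cancel.\<close>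

lemma cccp_step_iff:
  assumes "\<beta> > 0" and "energy_concave \<Omega> \<beta> X differentiable (at q)"
  shows "cccp_step (energy_concave \<Omega> \<beta> X) (energy_convex X) q q' \<longleftrightarrow>
    q' = transpose X *v regularized_argmax \<Omega> (\<beta> *\<^sub>R (X *v q))"
  using gderiv_energy_concave[OF assms]
  by (auto simp: cccp_step_def is_arg_min_energy_convex_linear dest: gderiv_unique)

section \<open>Differentiability under lower semicontinuity\<close>

lemma continuous_regularized_argmax:
  assumes lsc: "lower_semicontinuous \<Omega>"
  shows "continuous_on UNIV (regularized_argmax \<Omega>)"
proof (rule continuous_from_closed_graph[OF compact_prob_simplex])
  show "regularized_argmax \<Omega> \<in> UNIV \<rightarrow> prob_simplex"
    by (simp add: regularized_argmax_in_prob_simplex)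
  show "closed ((\<lambda>\<theta>. (\<theta>, regularized_argmax \<Omega> \<theta>)) ` UNIV)"
    unfolding closed_sequential_limits
  proof (intro allI impI, elim conjE)
    fix s and l :: "(real ^ 'n) \<times> (real ^ 'n)"
    assume "\<forall>k. s k \<in> range (\<lambda>\<theta>. (\<theta>, regularized_argmax \<Omega> \<theta>))" and lim: "s \<longlonglongrightarrow> l"
    define \<phi> where "\<phi> k = fst (s k)" for k
    define y where "y k = snd (s k)" for k
    define \<theta> where "\<theta> = fst l"
    define z where "z = snd l"
    have y: "y k = regularized_argmax \<Omega> (\<phi> k)" for k
      using \<open>\<forall>k. s k \<in> _\<close>[rule_format, of k] by (auto simp: y_def \<phi>_def)
    have lims [tendsto_intros]: "\<phi> \<longlonglongrightarrow> \<theta>" "y \<longlonglongrightarrow> z"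
      unfolding \<phi>_def y_def \<theta>_def z_def by (intro tendsto_fst tendsto_snd lim)+
    have z: "z \<in> prob_simplex"
      by (rule closed_sequentially[OF compact_imp_closed[OF compact_prob_simplex] _ lims(2)])
        (simp add: y regularized_argmax_in_prob_simplex)
    \<comment> \<open>The limit \<open>z\<close> does at least as well as each competitor
      \<open>w\<close>. Otherwise some \<open>c\<close> lies strictly between the two sides; lower
      semicontinuity eventually keeps \<open>\<Omega> (y k)\<close> above \<open>c\<close>, and the
      maximality of \<open>y k\<close> against \<open>w\<close> carries the bound by
      \<open>c\<close> to the limit, a contradiction.\<close>
    have "\<Omega> z \<le> ereal (\<theta> \<bullet> z - \<theta> \<bullet> w + real_of_ereal (\<Omega> w))" if w: "w \<in> prob_simplex" for w
    proof (rule ccontr)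
      assume "\<not> ?thesis"
      then obtain c where c: "\<theta> \<bullet> z - \<theta> \<bullet> w + real_of_ereal (\<Omega> w) < c" "ereal c < \<Omega> z"
        using ereal_dense2 by (metis ereal_less(2) less_ereal.simps(1) not_le)
      then have "\<forall>\<^sub>F x in nhds z. ereal c < \<Omega> x"
        using lsc by (auto simp: lower_semicontinuous_def eventually_nhds_conv_at)
      then have ev: "\<forall>\<^sub>F k in sequentially. ereal c < \<Omega> (y k)"
        using lims(2) by (rule eventually_compose_filterlim)
      have "c \<le> \<phi> k \<bullet> y k - \<phi> k \<bullet> w + real_of_ereal (\<Omega> w)" if "ereal c < \<Omega> (y k)" for k
      proof -
        have "c < real_of_ereal (\<Omega> (y k))"
          using that negentropy_ereal[OF regularized_argmax_in_prob_simplex, of "\<phi> k"]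
          by (metis y less_ereal.simps(1))
        then show ?thesis
          using fenchel_young_inequality[OF w, of "\<phi> k"] real_fenchel_conjugate[of "\<phi> k"]
          by (simp add: y)
      qed
      with ev have "\<forall>\<^sub>F k in sequentially. c \<le> \<phi> k \<bullet> y k - \<phi> k \<bullet> w + real_of_ereal (\<Omega> w)"
        by (rule eventually_mono)
      moreover have "(\<lambda>k. \<phi> k \<bullet> y k - \<phi> k \<bullet> w + real_of_ereal (\<Omega> w))
          \<longlonglongrightarrow> \<theta> \<bullet> z - \<theta> \<bullet> w + real_of_ereal (\<Omega> w)"
        by (intro tendsto_intros)
      ultimately have "c \<le> \<theta> \<bullet> z - \<theta> \<bullet> w + real_of_ereal (\<Omega> w)"
        by (intro tendsto_lowerbound) auto
      with c show False by simp
    qed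
    then have "real_of_ereal (\<Omega> z) \<le> \<theta> \<bullet> z - \<theta> \<bullet> w + real_of_ereal (\<Omega> w)"
      if "w \<in> prob_simplex" for w
      using negentropy_ereal[OF z] that by (metis ereal_less_eq(3))
    then have "ereal (\<theta> \<bullet> w) - ereal (real_of_ereal (\<Omega> w))
        \<le> ereal (\<theta> \<bullet> z) - ereal (real_of_ereal (\<Omega> z))" if "w \<in> prob_simplex" for w
      using that by (simp add: algebra_simps)
    then have "ereal (\<theta> \<bullet> w) - \<Omega> w \<le> ereal (\<theta> \<bullet> z) - \<Omega> z" if "w \<in> prob_simplex" for w
      using negentropy_ereal[OF that] negentropy_ereal[OF z] that by metis
    with z have "is_arg_max (\<lambda>y. ereal (\<theta> \<bullet> y) - \<Omega> y) (\<lambda>y. y \<in> prob_simplex) z"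
      by (simp add: is_arg_max_linorder)
    \<comment> \<open>Uniqueness of the maximizer puts the limit on the graph.\<close>
    then have "regularized_argmax \<Omega> \<theta> = z"
      by (rule regularized_argmax_unique[OF neg])
    then show "l \<in> range (\<lambda>\<theta>. (\<theta>, regularized_argmax \<Omega> \<theta>))"
      by (intro image_eqI[of _ _ \<theta>]) (simp_all add: prod_eq_iff \<theta>_def z_def)
  qed
qed

lemma gderiv_fenchel_conjugate:
  assumes "lower_semicontinuous \<Omega>"
  shows "GDERIV (\<lambda>\<theta>. real_of_ereal (fenchel_conjugate \<Omega> \<theta>)) \<theta> :> regularized_argmax \<Omega> \<theta>"
  unfolding gderiv_def has_derivative_iff_norm
proof (intro conjI)
  let ?f = "\<lambda>\<theta>. real_of_ereal (fenchel_conjugate \<Omega> \<theta>)"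
  let ?y = "regularized_argmax \<Omega>"
  show "bounded_linear (\<lambda>h. h \<bullet> ?y \<theta>)" by (rule bounded_linear_inner_left)
  have "(?y \<longlongrightarrow> ?y \<theta>) (at \<theta>)"
    using continuous_regularized_argmax[OF assms] by (simp add: continuous_on_def)
  then have lim: "((\<lambda>\<phi>. norm (?y \<phi> - ?y \<theta>)) \<longlongrightarrow> 0) (at \<theta>)"
    by (simp add: tendsto_norm_zero_iff LIM_zero_iff)
  have "norm (?f \<phi> - ?f \<theta> - (\<phi> - \<theta>) \<bullet> ?y \<theta>) \<le> norm (?y \<phi> - ?y \<theta>) * norm (\<phi> - \<theta>)" for \<phi>
  proof -
    \<comment> \<open>The subgradient inequality at \<open>\<theta>\<close> makes the remainder
      nonnegative, the one at \<open>\<phi>\<close> bounds it from above.\<close>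
    have "norm (?f \<phi> - ?f \<theta> - (\<phi> - \<theta>) \<bullet> ?y \<theta>) \<le> (\<phi> - \<theta>) \<bullet> (?y \<phi> - ?y \<theta>)"
      using fenchel_conjugate_subgradient[of \<theta> \<phi>] fenchel_conjugate_subgradient[of \<phi> \<theta>]
      by (simp add: inner_diff_left inner_diff_right)
    also have "\<dots> \<le> norm (\<phi> - \<theta>) * norm (?y \<phi> - ?y \<theta>)" by (rule norm_cauchy_schwarz)
    finally show ?thesis by (simp add: mult.commute)
  qed
  then show "((\<lambda>\<phi>. norm (?f \<phi> - ?f \<theta> - (\<phi> - \<theta>) \<bullet> ?y \<theta>) / norm (\<phi> - \<theta>)) \<longlongrightarrow> 0) (at \<theta>)"
    \<comment> \<open>At \<open>\<phi> = \<theta>\<close> the quotient is 0, as division by 0 gives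
      0, so the bounds hold for all \<open>\<phi>\<close>.\<close>
    by (intro tendsto_sandwich[OF _ _ tendsto_const lim] always_eventually)
      (auto simp: divide_le_eq)
qed

lemma energy_concave_differentiable:
  assumes "\<beta> > 0" and "lower_semicontinuous \<Omega>"
  shows "energy_concave \<Omega> \<beta> X differentiable (at q)"
proof -
  let ?A = "\<lambda>q. \<beta> *\<^sub>R (X *v q)"
  have "(\<lambda>\<theta>. real_of_ereal (fenchel_conjugate \<Omega> \<theta>)) differentiable (at (?A q))"
    using gderiv_fenchel_conjugate[OF assms(2)] by (auto simp: gderiv_def differentiable_def)
  moreover have "?A differentiable (at q)"
    by (intro linear_imp_differentiable linear_compose_scale_right matrix_vector_mul_linear)
  ultimately have "(\<lambda>q. real_of_ereal (fenchel_conjugate \<Omega> (?A q))) differentiable (at q)"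
    using differentiable_chain_at[of ?A q] by (simp add: o_def)
  then show ?thesis
    unfolding energy_concave_eq[OF assms(1), abs_def] divide_inverse
    by (intro derivative_intros) auto
qed

end

end

text \<open>By \<open>convex_hull_rows\<close>, the hull consists of the points
  \<open>transpose X *v y\<close> with \<open>y\<close> in the simplex. A CCCP step requires a
  gradient of the concave part, hence the differentiability premise; the last clause supplies it for
  lower semicontinuous \<open>\<Omega>\<close>.\<close>

theorem proposition1:
  fixes X :: "real ^ 'd ^ 'n" and \<beta> :: real and \<Omega> :: "real ^ 'n \<Rightarrow> ereal"
  assumes "\<beta> > 0"
    and "generalized_negentropy \<Omega>"
    and "regularized_argmax_attained \<Omega>"
  shows "(\<forall>q \<in> convex hull (rows X).
            0 \<le> hfy_energy \<Omega> \<beta> X q \<and>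
            hfy_energy \<Omega> \<beta> X q \<le>
              min (2 * (max_row_norm X)\<^sup>2)
                  (- (1 / \<beta>) * real_of_ereal (\<Omega> uniform_vec) + 1/2 * (max_row_norm X)\<^sup>2))
       \<and> (\<forall>q q'. energy_concave \<Omega> \<beta> X differentiable (at q) \<longrightarrow>
            (cccp_step (energy_concave \<Omega> \<beta> X) (energy_convex X) q q' \<longleftrightarrow>
             q' = transpose X *v regularized_argmax \<Omega> (\<beta> *\<^sub>R (X *v q))))
       \<and> (lower_semicontinuous \<Omega> \<longrightarrow>
            (\<forall>q. energy_concave \<Omega> \<beta> X differentiable (at q)))"
proof (intro conjI ballI allI impI)
  fix q assume q: "q \<in> convex hull (rows X)"
  show "0 \<le> hfy_energy \<Omega> \<beta> X q"
    by (rule hfy_energy_nonneg[OF assms(2,3,1)])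
  show "hfy_energy \<Omega> \<beta> X q \<le> min (2 * (max_row_norm X)\<^sup>2)
      (- (1 / \<beta>) * real_of_ereal (\<Omega> uniform_vec) + 1/2 * (max_row_norm X)\<^sup>2)"
    using hfy_energy_le_norm_bound[OF assms(2,3,1) q]
      hfy_energy_le_negentropy_bound[OF assms(2,3,1) q] by simp
next
  fix q q'
  assume "energy_concave \<Omega> \<beta> X differentiable (at q)"
  then show "cccp_step (energy_concave \<Omega> \<beta> X) (energy_convex X) q q' \<longleftrightarrow>
      q' = transpose X *v regularized_argmax \<Omega> (\<beta> *\<^sub>R (X *v q))"
    by (rule cccp_step_iff[OF assms(2,3,1)])
next
  fix q
  assume "lower_semicontinuous \<Omega>"
  then show "energy_concave \<Omega> \<beta> X differentiable (at q)"
    by (rule energy_concave_differentiable[OF assms(2,3,1)])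
qed

end
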